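(* For $N=9$, $$\Lambda_k(9)>A_9=\frac{49}{4}\qquad(1\le k\le 9).$$ Equivalently, the matrix $M_9^{(9)}-\frac{49}{4}I$ is positive definite.
   Context: For integers $1\le k\le N$, $M_N^{(k)}$ is the $k\times k$ real symmetric tridiagonal matrix with $(M_N^{(k)})_{jj}=2Nj$ for $1\le j\le k$ and $(M_N^{(k)})_{j,j+1}=(M_N^{(k)})_{j+1,j}=-(j+1)\sqrt{2j(N-j)}$ for $1\le j<k$; $\Lambda_k(N):=\lambda_{\min}(M_N^{(k)})$ is its smallest eigenvalue. Also $A_N=(N-2)^2/4$. *)

theory Defs
  imports "Jordan_Normal_Form.Spectral_Radius"
begin

text \<open>
  The indices \<open>i\<close>, \<open>j\<close> of \<open>tri_entry\<close> start at 1, while the matrices of the library are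
  indexed from 0; the shift by one takes place in \<open>tri_mat\<close>.
\<close>

definition tri_entry :: "nat \<Rightarrow> nat \<Rightarrow> nat \<Rightarrow> real" where
  "tri_entry N i j =
    (if i = j then 2 * real N * real j
     else if i = j + 1 then - (real j + 1) * sqrt (2 * real j * (real N - real j))
     else if j = i + 1 then - (real i + 1) * sqrt (2 * real i * (real N - real i))
     else 0)"

definition tri_mat :: "nat \<Rightarrow> nat \<Rightarrow> real mat" where
  "tri_mat N k = mat k k (\<lambda>(i, j). tri_entry N (i + 1) (j + 1))"

text \<open>
  Meaningful when the real spectrum is nonempty, in particular for every symmetric real
  matrix of positive dimension, whose real spectrum contains all its eigenvalues.
\<close>

definition min_eigenvalue :: "real mat \<Rightarrow> real" where
  "min_eigenvalue A = Min (spectrum A)"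

definition Lam :: "nat \<Rightarrow> nat \<Rightarrow> real" where
  "Lam k N = min_eigenvalue (tri_mat N k)"

definition A_level :: "nat \<Rightarrow> real" where
  "A_level N = (real N - 2)\<^sup>2 / 4"

definition positive_definite :: "real mat \<Rightarrow> bool" where
  "positive_definite A \<longleftrightarrow>
    square_mat A \<and> A\<^sup>T = A \<and>
    (\<forall>v \<in> carrier_vec (dim_row A). v \<noteq> 0\<^sub>v (dim_row A) \<longrightarrow> v \<bullet> (A *\<^sub>v v) > 0)"

end

theory Submission
  imports Defs
begin

text \<open>
  The quadratic form of every \<open>tri_mat 9 k\<close> with \<open>1 \<le> k \<le> 9\<close> is bounded below by \<open>13 * \<parallel>x\<parallel>\<^sup>2\<close>,
  and \<open>13 > 49/4\<close>; both the eigenvalue bound and the positive definiteness follow at once.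

  The bound comes from completing squares. With 1-based indices, write \<open>b\<^sub>j\<close> for the
  off-diagonal entry in position \<open>(j, j + 1)\<close>, so that
  \<open>b\<^sub>j\<^sup>2 = 2 j (9 - j) (j + 1)\<^sup>2\<close>, and split the mixed terms by
  \<open>2 b\<^sub>j x\<^sub>j x\<^sub>j\<^sub>+\<^sub>1 \<ge> - d\<^sub>j x\<^sub>j\<^sup>2 - (b\<^sub>j\<^sup>2 / d\<^sub>j) x\<^sub>j\<^sub>+\<^sub>1\<^sup>2\<close>. The exact pivots of
  \<open>M - 49/4\<close> are unwieldy rationals, but there is enough room to replace them by
  \<open>d\<^sub>j = 5 j\<close>. The factor \<open>j\<close> cancels in \<open>b\<^sub>j\<^sup>2 / d\<^sub>j = 2 (9 - j) (j + 1)\<^sup>2 / 5\<close>, and what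
  remains on the diagonal is at least 13 because
  \<open>13 (j + 1) - 2 (9 - j) (j + 1)\<^sup>2 / 5 \<ge> 13\<close> for \<open>1 \<le> j \<le> 8\<close>.
  In the first row \<open>18 - d\<^sub>1 = 13\<close> exactly.

  The smallest eigenvalue is defined as the minimum of the real spectrum, so it must also be
  known that this spectrum is not empty: a complex eigenvalue of a real symmetric matrix
  exists, is real, and is then a root of the real characteristic polynomial.
\<close>

section \<open>Real symmetric matrices have a real eigenvalue\<close>

text \<open>
  Let \<open>A v = c v\<close> with \<open>v\<close> complex and let \<open>w\<close> be the conjugate of \<open>v\<close>. Since \<open>A\<close> is real,
  \<open>A w = cnj c w\<close>, and moving \<open>A\<close> across the bilinear product gives
  \<open>cnj c * (w \<bullet> v) = A w \<bullet> v = w \<bullet> A v = c * (w \<bullet> v)\<close>, where \<open>w \<bullet> v\<close> is the squared length of \<open>v\<close>.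
\<close>

lemma symmetric_real_mat_complex_eigenvalue_real:
  fixes A :: "real mat"
  assumes A: "A \<in> carrier_mat n n" and sym: "A\<^sup>T = A"
    and ev: "eigenvalue (map_mat complex_of_real A) c"
  shows "c \<in> \<real>"
proof -
  let ?A = "map_mat complex_of_real A"
  have cA: "?A \<in> carrier_mat n n" using A by simp
  have symc: "?A\<^sup>T = ?A" using sym by (simp add: map_mat_transpose)
  obtain v where v: "v \<in> carrier_vec n" "v \<noteq> 0\<^sub>v n" and Av: "?A *\<^sub>v v = c \<cdot>\<^sub>v v"
    using ev A unfolding eigenvalue_def eigenvector_def by auto
  let ?w = "conjugate v"
  have w: "?w \<in> carrier_vec n" using v by simp
  have "conjugate (?A *\<^sub>v v) = ?A *\<^sub>v ?w"
  proof (rule eq_vecI)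
    fix i assume "i < dim_vec (?A *\<^sub>v ?w)"
    then have i: "i < n" using A by simp
    have "conjugate (row ?A i) = row ?A i"
      using i A by (intro eq_vecI) auto
    then show "conjugate (?A *\<^sub>v v) $ i = (?A *\<^sub>v ?w) $ i"
      using i A v conjugate_sprod_vec[of "row ?A i" n v] by auto
  qed (use A in simp)
  then have Aw: "?A *\<^sub>v ?w = cnj c \<cdot>\<^sub>v ?w"
    by (simp add: Av conjugate_smult_vec)
  have "cnj c * (?w \<bullet> v) = (?A\<^sup>T *\<^sub>v ?w) \<bullet> v"
    using v w by (simp add: symc Aw)
  also have "\<dots> = ?w \<bullet> (?A *\<^sub>v v)"
    by (rule transpose_vec_mult_scalar[OF cA v(1) w])
  also have "\<dots> = c * (?w \<bullet> v)"
    using v w by (simp add: Av)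
  finally have "cnj c * (?w \<bullet> v) = c * (?w \<bullet> v)" .
  moreover have "?w \<bullet> v \<noteq> 0"
    using v conjugate_vec_sprod_comm[OF v(1) v(1)] conjugate_square_eq_0_vec[OF v(1)] by simp
  ultimately have "cnj c = c" by simp
  then show ?thesis by (simp add: Reals_cnj_iff)
qed

lemma symmetric_real_mat_spectrum_nonempty:
  fixes A :: "real mat"
  assumes A: "A \<in> carrier_mat n n" and sym: "A\<^sup>T = A" and n: "n > 0"
  shows "spectrum A \<noteq> {}"
proof -
  let ?A = "map_mat complex_of_real A"
  have cA: "?A \<in> carrier_mat n n" using A by simp
  obtain c where c: "eigenvalue ?A c"
    using spectrum_non_empty[OF cA n] unfolding spectrum_def by auto
  obtain r where r: "c = of_real r"
    using symmetric_real_mat_complex_eigenvalue_real[OF A sym c] by (elim Reals_cases)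
  have "poly (map_poly of_real (char_poly A)) (complex_of_real r) = 0"
    using c eigenvalue_root_char_poly[OF cA] by (simp add: r of_real_hom.char_poly_hom[OF A])
  then have "poly (char_poly A) r = 0" by simp
  then show ?thesis using spectrum_root_char_poly[OF A] by auto
qed

text \<open>
  Only the quadratic form at a real eigenvector has to be inspected; the nonempty
  spectrum guarantees that the minimum is attained at one.
\<close>

lemma min_eigenvalue_ge:
  fixes A :: "real mat"
  assumes A: "A \<in> carrier_mat n n" and sym: "A\<^sup>T = A" and n: "n > 0"
    and form: "\<And>v. v \<in> carrier_vec n \<Longrightarrow> \<mu> * (v \<bullet> v) \<le> v \<bullet> (A *\<^sub>v v)"
  shows "\<mu> \<le> min_eigenvalue A"
proof -
  have "min_eigenvalue A \<in> spectrum A"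
    unfolding min_eigenvalue_def
    using card_finite_spectrum(1)[OF A] symmetric_real_mat_spectrum_nonempty[OF A sym n]
    by (rule Min_in)
  then obtain v where v: "v \<in> carrier_vec n" "v \<noteq> 0\<^sub>v n"
    and Av: "A *\<^sub>v v = min_eigenvalue A \<cdot>\<^sub>v v"
    using A unfolding spectrum_def eigenvalue_def eigenvector_def by auto
  have pos: "v \<bullet> v > 0"
    using conjugate_square_greater_0_vec[OF v(1)] v(2) by simp
  have "\<mu> * (v \<bullet> v) \<le> min_eigenvalue A * (v \<bullet> v)"
    using form[OF v(1)] v(1) by (simp add: Av)
  then show ?thesis using pos by simp
qed

section \<open>Tridiagonal quadratic forms\<close>

text \<open>
  Completing squares from the first variable on. The numbers \<open>d i\<close> are lower bounds for
  the pivots of \<open>T - \<mu>\<close>; an inequality in the recursion suffices, which leaves the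
  freedom to choose them simple. The term with \<open>d n\<close> is what the last variable still
  has to spare for its mixed term with the next one.
\<close>

lemma tridiagonal_form_ge:
  fixes T :: "nat \<Rightarrow> nat \<Rightarrow> real"
  assumes sym: "\<And>i j. T i j = T j i"
    and tri: "\<And>i j. i + 1 < j \<Longrightarrow> T i j = 0"
    and first: "\<mu> + d 0 \<le> T 0 0"
    and pos: "\<And>i. i < n \<Longrightarrow> d i > 0"
    and pivot: "\<And>i. i < n \<Longrightarrow> \<mu> + d (Suc i) + (T i (Suc i))\<^sup>2 / d i \<le> T (Suc i) (Suc i)"
  shows "\<mu> * (\<Sum>i<Suc n. (x i)\<^sup>2) + d n * (x n)\<^sup>2 \<le> (\<Sum>i<Suc n. x i * (\<Sum>j<Suc n. T i j * x j))"
  using pos pivot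
proof (induction n)
  case 0
  show ?case
    using mult_right_mono[OF first, of "(x 0)\<^sup>2"] by (simp add: power2_eq_square algebra_simps)
next
  case (Suc n)
  define Q where "Q m = (\<Sum>i<m. x i * (\<Sum>j<m. T i j * x j))" for m
  let ?b = "T n (Suc n)" and ?y = "x (Suc n)"
  have dn: "d n > 0" using Suc.prems(1) by simp
  have IH: "\<mu> * (\<Sum>i<Suc n. (x i)\<^sup>2) + d n * (x n)\<^sup>2 \<le> Q (Suc n)"
    unfolding Q_def by (rule Suc.IH) (use Suc.prems in auto)
  have col: "(\<Sum>i<Suc n. x i * T i (Suc n)) = x n * ?b"
    using tri by simp
  have row: "(\<Sum>j<Suc n. T (Suc n) j * x j) = x n * ?b"
    using col sym by (simp add: mult.commute)
  have "Q (Suc (Suc n)) = (\<Sum>i<Suc n. x i * (\<Sum>j<Suc n. T i j * x j) + (x i * T i (Suc n)) * ?y)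
      + ?y * ((\<Sum>j<Suc n. T (Suc n) j * x j) + T (Suc n) (Suc n) * ?y)"
    unfolding Q_def sum.lessThan_Suc[of _ "Suc n"] by (simp only: distrib_left mult.assoc)
  also have "\<dots> = Q (Suc n) + (\<Sum>i<Suc n. x i * T i (Suc n)) * ?y
      + ?y * ((\<Sum>j<Suc n. T (Suc n) j * x j) + T (Suc n) (Suc n) * ?y)"
    unfolding Q_def by (simp only: sum.distrib sum_distrib_right)
  also have "\<dots> = Q (Suc n) + 2 * ?b * x n * ?y + T (Suc n) (Suc n) * ?y\<^sup>2"
    unfolding col row by (simp add: power2_eq_square algebra_simps)
  finally have step: "Q (Suc (Suc n)) = Q (Suc n) + 2 * ?b * x n * ?y + T (Suc n) (Suc n) * ?y\<^sup>2" .
  have "0 \<le> (d n * x n + ?b * ?y)\<^sup>2 / d n" using dn by simp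
  also have "\<dots> = d n * (x n)\<^sup>2 + 2 * ?b * x n * ?y + ?b\<^sup>2 / d n * ?y\<^sup>2"
    using dn by (simp add: power2_eq_square field_simps)
  finally have square: "0 \<le> d n * (x n)\<^sup>2 + 2 * ?b * x n * ?y + ?b\<^sup>2 / d n * ?y\<^sup>2" .
  have "(\<mu> + d (Suc n) + ?b\<^sup>2 / d n) * ?y\<^sup>2 \<le> T (Suc n) (Suc n) * ?y\<^sup>2"
    using Suc.prems(2)[of n] by (intro mult_right_mono) auto
  then have "\<mu> * ((\<Sum>i<Suc n. (x i)\<^sup>2) + ?y\<^sup>2) + d (Suc n) * ?y\<^sup>2 \<le> Q (Suc (Suc n))"
    using IH square step by (simp add: distrib_left distrib_right)
  then show ?case unfolding Q_def by (simp only: sum.lessThan_Suc[of _ "Suc n"])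
qed

section \<open>The matrices for \<open>N = 9\<close>\<close>

lemma tri_mat_carrier: "tri_mat N k \<in> carrier_mat k k"
  unfolding tri_mat_def by simp

lemma tri_entry_sym: "tri_entry N i j = tri_entry N j i"
  unfolding tri_entry_def by auto

lemma tri_mat_sym: "(tri_mat N k)\<^sup>T = tri_mat N k"
  unfolding tri_mat_def by (rule eq_matI) (auto simp: tri_entry_sym)

lemma tri_mat_form:
  assumes "v \<in> carrier_vec k"
  shows "v \<bullet> (tri_mat N k *\<^sub>v v) =
    (\<Sum>i<k. v $ i * (\<Sum>j<k. tri_entry N (Suc i) (Suc j) * v $ j))"
  using assms unfolding tri_mat_def scalar_prod_def
  by (auto simp: scalar_prod_def atLeast0LessThan intro!: sum.cong)

text \<open>
  In 0-based indices the pivot bounds are \<open>d i = 5 (i + 1)\<close>. Cleared of denominators, the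
  recursion for them is \<open>2 (i + 2)\<^sup>2 (8 - i) \<le> 65 (i + 1)\<close>; it is tight within 4 for the
  first three indices and is checked at each of the eight.
\<close>

lemma tri_mat_9_form_ge:
  assumes k: "1 \<le> k" "k \<le> 9" and v: "v \<in> carrier_vec k"
  shows "13 * (v \<bullet> v) \<le> v \<bullet> (tri_mat 9 k *\<^sub>v v)"
proof -
  let ?T = "\<lambda>i j. tri_entry 9 (Suc i) (Suc j)"
  let ?d = "\<lambda>i. 5 * (real i + 1)"
  obtain n where n: "k = Suc n" "n \<le> 8" using k by (cases k) auto
  have "13 * (\<Sum>i<Suc n. (v $ i)\<^sup>2) + ?d n * (v $ n)\<^sup>2
      \<le> (\<Sum>i<Suc n. v $ i * (\<Sum>j<Suc n. ?T i j * v $ j))"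
  proof (rule tridiagonal_form_ge)
    fix i assume "i < n"
    then have i: "i < 8" using n by simp
    have off: "(?T i (Suc i))\<^sup>2 / ?d i = 2 * (real i + 2)\<^sup>2 * (8 - real i) / 5"
      using i by (simp add: tri_entry_def power_mult_distrib divide_simps)
        (simp add: power2_eq_square algebra_simps)
    have "i \<in> {0, 1, 2, 3, 4, 5, 6, 7}" using i by auto
    then have "2 * (real i + 2)\<^sup>2 * (8 - real i) \<le> 65 * (real i + 1)"
      by auto
    then show "13 + ?d (Suc i) + (?T i (Suc i))\<^sup>2 / ?d i \<le> ?T (Suc i) (Suc i)"
      unfolding off by (simp add: tri_entry_def)
  qed (auto simp: tri_entry_sym, auto simp: tri_entry_def)
  moreover have "0 \<le> ?d n * (v $ n)\<^sup>2" by simp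
  moreover have "v \<bullet> v = (\<Sum>i<Suc n. (v $ i)\<^sup>2)"
    using v n by (simp add: scalar_prod_def atLeast0LessThan power2_eq_square)
  ultimately show ?thesis
    using tri_mat_form[OF v, of 9] unfolding n(1) by linarith
qed

theorem proposition5p5:
  shows "(\<forall>k::nat. 1 \<le> k \<and> k \<le> 9 \<longrightarrow> Lam k 9 > A_level 9)
    \<and> A_level 9 = 49 / 4
    \<and> positive_definite (tri_mat 9 9 - (49 / 4) \<cdot>\<^sub>m 1\<^sub>m 9)"
proof (intro conjI allI impI)
  show level: "A_level 9 = 49 / 4"
    by (simp add: A_level_def)
  fix k :: nat assume k: "1 \<le> k \<and> k \<le> 9"
  have "13 \<le> Lam k 9"
    unfolding Lam_def
    by (rule min_eigenvalue_ge[OF tri_mat_carrier tri_mat_sym]) (use k tri_mat_9_form_ge in auto)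
  then show "Lam k 9 > A_level 9" using level by simp
next
  let ?M = "tri_mat 9 9" and ?S = "(49 / 4) \<cdot>\<^sub>m 1\<^sub>m 9 :: real mat"
  have M: "?M \<in> carrier_mat 9 9" by (rule tri_mat_carrier)
  have S: "?S \<in> carrier_mat 9 9" by simp
  have S_sym: "?S\<^sup>T = ?S" by (rule eq_matI) auto
  have "(?M - ?S)\<^sup>T = ?M - ?S"
    using M by (simp add: transpose_minus[OF M S] tri_mat_sym S_sym)
  moreover have "v \<bullet> ((?M - ?S) *\<^sub>v v) > 0" if v: "v \<in> carrier_vec 9" "v \<noteq> 0\<^sub>v 9" for v
  proof -
    have pos: "v \<bullet> v > 0"
      using conjugate_square_greater_0_vec[OF v(1)] v(2) by simp
    have "?S *\<^sub>v v = (49 / 4) \<cdot>\<^sub>v v"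
      using v(1) by (intro eq_vecI) auto
    then have "v \<bullet> ((?M - ?S) *\<^sub>v v) = v \<bullet> (?M *\<^sub>v v) - 49 / 4 * (v \<bullet> v)"
      using v(1) M S
      by (simp add: minus_mult_distrib_mat_vec[OF M S v(1)] scalar_prod_minus_distrib[of v 9])
    then show ?thesis using tri_mat_9_form_ge[of 9 v] v(1) pos by simp
  qed
  ultimately show "positive_definite (?M - ?S)"
    using M unfolding positive_definite_def by simp
qed

end
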